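(* (Limiting Amplitude Principle) Consider any of the three types of boundary conditions (DD, NN or DN). Let $\omega_0\in\mathbb{R}\setminus\{0\}$, $a^0\in\mathbb{C}$, and $F^0(t):=a^0e^{-i\omega_0t}h(t)$, where $h$ is the Heaviside function. Let $F\in L^1_{loc}(\mathbb{R})$ satisfy $F(s)=0$ for $s<0$ and $\sup_{s\in\mathbb{R}}(1+|s|)^p|F(s)|<\infty$ for some $p\in\mathbb{R}$, and suppose that $$R(t):=F(t)-F^0(t)\to0,\qquad t\to\infty.$$ Then for any $\delta>0$ $$A_d(\rho,\theta,t)-A^0(\rho,\theta)\to0,\qquad t\to\infty,$$ uniformly in bounded $\rho>0$ (i.e. in $0<\rho\le b$ for every $b<\infty$) and in $\theta\in[\phi,2\pi]$ with $|\theta-\theta_k|\ge\delta$, $k=1,2$.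
   Context: Fix $\phi\in(0,\pi)$, $\Phi:=2\pi-\phi$, $q:=\pi/(2\Phi)$, and $\alpha$ with $\max(0,\phi-\pi/2)<\alpha<\min(\pi/2,\phi)$ (standing assumption). Put $\theta_1:=2\phi-\alpha$, $\theta_2:=2\pi-\alpha$, $\Theta:=[\phi,2\pi]\setminus\{\theta_1,\theta_2\}$. Kernel. $H(\beta)=\coth(q(\beta+\tfrac{i\pi}2-i\alpha))\mp\coth(q(\beta-\tfrac{3i\pi}2+i\alpha))$ for DD (upper sign) and NN (lower sign), $H(\beta)=\dfrac1{\sinh(q(\beta+\frac{i\pi}2-i\alpha))}+\dfrac1{\sinh(q(\beta-\frac{3i\pi}2+i\alpha))}$ for DN; $Z(\beta)=-H(\beta-\tfrac{i\pi}2)+H(\beta-\tfrac{5i\pi}2)$. Let $l(\lambda)=\ln(\lambda+\sqrt{\lambda^2-1})$ for $\lambda\ge1$ and $l(\lambda)=0$ for $\lambda\in(0,1)$. The amplitude of the diffracted wave with profile $F$ is $$A_d(\rho,\theta,t):=e^{i\omega_0t}\frac{i}{4\Phi}\int_{-l(t/\rho)}^{l(t/\rho)}Z(\beta+i\theta)F(t-\rho\cosh\beta)\,d\beta,\qquad\rho>0,\ \theta\in\Theta,\ t>0,$$ and the limiting amplitude is $$A^0(\rho,\theta):=\frac{i}{4\Phi}\int_{\mathbb{R}}a^0e^{i\omega_0\rho\cosh\beta}Z(\beta+i\theta)\,d\beta,\qquad\rho>0,\ \theta\in\Theta.$$ *)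

theory Defs
  imports "HOL-Analysis.Analysis"
begin

datatype boundary_type = DD | NN | DN

(* The poles of coth and of 1 / sinh get the value 0 by x / 0 = 0. For 0 < alpha < phi < pi and
   phi \<le> theta \<le> 2 pi,
   the line beta + i theta meets a pole of Zker only if theta is theta1 or theta2. *)
definition coth :: "complex \<Rightarrow> complex" where
  "coth z = cosh z / sinh z"

definition \<Phi> :: "real \<Rightarrow> real" where
  "\<Phi> \<phi> = 2 * pi - \<phi>"

definition q :: "real \<Rightarrow> real" where
  "q \<phi> = pi / (2 * \<Phi> \<phi>)"

definition \<theta>1 :: "real \<Rightarrow> real \<Rightarrow> real" where
  "\<theta>1 \<phi> \<alpha> = 2 * \<phi> - \<alpha>"

definition \<theta>2 :: "real \<Rightarrow> real" where
  "\<theta>2 \<alpha> = 2 * pi - \<alpha>"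

fun Hker :: "boundary_type \<Rightarrow> real \<Rightarrow> real \<Rightarrow> complex \<Rightarrow> complex" where
  "Hker DD \<phi> \<alpha> \<beta> =
     coth (q \<phi> * (\<beta> + \<i> * pi / 2 - \<i> * \<alpha>)) - coth (q \<phi> * (\<beta> - 3 * \<i> * pi / 2 + \<i> * \<alpha>))"
| "Hker NN \<phi> \<alpha> \<beta> =
     coth (q \<phi> * (\<beta> + \<i> * pi / 2 - \<i> * \<alpha>)) + coth (q \<phi> * (\<beta> - 3 * \<i> * pi / 2 + \<i> * \<alpha>))"
| "Hker DN \<phi> \<alpha> \<beta> =
     1 / sinh (q \<phi> * (\<beta> + \<i> * pi / 2 - \<i> * \<alpha>))
     + 1 / sinh (q \<phi> * (\<beta> - 3 * \<i> * pi / 2 + \<i> * \<alpha>))"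

definition Zker :: "boundary_type \<Rightarrow> real \<Rightarrow> real \<Rightarrow> complex \<Rightarrow> complex" where
  "Zker bc \<phi> \<alpha> \<beta> = - Hker bc \<phi> \<alpha> (\<beta> - \<i> * pi / 2) + Hker bc \<phi> \<alpha> (\<beta> - 5 * \<i> * pi / 2)"

definition ell :: "real \<Rightarrow> real" where
  "ell x = (if x \<ge> 1 then ln (x + sqrt (x\<^sup>2 - 1)) else 0)"

(* Integrals are Lebesgue integrals over the completed measure, since the profile F
   is only Lebesgue (not necessarily Borel) measurable. *)
definition diffracted_amplitude ::
  "boundary_type \<Rightarrow> real \<Rightarrow> real \<Rightarrow> real \<Rightarrow> (real \<Rightarrow> complex) \<Rightarrow> real \<Rightarrow> real \<Rightarrow> real \<Rightarrow> complex" where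
  "diffracted_amplitude bc \<phi> \<alpha> \<omega>0 F \<rho> \<theta> t =
     exp (\<i> * \<omega>0 * t) * (\<i> / (4 * \<Phi> \<phi>)) *
     (LINT \<beta>:{- ell (t / \<rho>)..ell (t / \<rho>)}|lebesgue.
        Zker bc \<phi> \<alpha> (of_real \<beta> + \<i> * \<theta>) * F (t - \<rho> * cosh \<beta>))"

definition limiting_amplitude ::
  "boundary_type \<Rightarrow> real \<Rightarrow> real \<Rightarrow> real \<Rightarrow> complex \<Rightarrow> real \<Rightarrow> real \<Rightarrow> complex" where
  "limiting_amplitude bc \<phi> \<alpha> \<omega>0 a0 \<rho> \<theta> =
     \<i> / (4 * \<Phi> \<phi>) *
     (LINT \<beta>|lebesgue. a0 * exp (\<i> * \<omega>0 * \<rho> * of_real (cosh \<beta>)) * Zker bc \<phi> \<alpha> (of_real \<beta> + \<i> * \<theta>))"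

definition heaviside :: "real \<Rightarrow> real" where
  "heaviside t = (if t > 0 then 1 else 0)"

definition harmonic_profile :: "real \<Rightarrow> complex \<Rightarrow> real \<Rightarrow> complex" where
  "harmonic_profile \<omega>0 a0 t = a0 * exp (- \<i> * \<omega>0 * t) * heaviside t"

definition locally_L1 :: "(real \<Rightarrow> complex) \<Rightarrow> bool" where
  "locally_L1 F \<longleftrightarrow> (\<forall>K. compact K \<longrightarrow> F absolutely_integrable_on K)"

end

theory Submission
  imports Defs
begin

text \<open>On a line \<open>\<beta> + i\<theta>\<close> that stays away from \<open>\<theta>\<^sub>1\<close> and \<open>\<theta>\<^sub>2\<close> the four terms of the
  kernel stay away from their poles, and the kernel is \<open>O(1 / cosh (q\<beta>))\<close> uniformly in \<open>\<theta>\<close>; for DD and NN the decay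
  comes from pairing the four \<open>coth\<close> terms into differences with arguments \<open>2\<pi>iq\<close> apart. Writing both
  amplitudes as integrals over the whole line, their integrands differ for \<open>\<bar>\<beta>\<bar> \<le> L\<close> by the kernel times
  the remainder \<open>R(t - \<rho> cosh \<beta>)\<close>, small uniformly in \<open>\<rho> \<le> b\<close> for large \<open>t\<close>; for \<open>\<bar>\<beta>\<bar> > L\<close>
  both are dominated by the integrable tail of the kernel bound, since \<open>F\<close> is bounded.\<close>

section \<open>Growth of sinh along horizontal lines\<close>

text \<open>The identity |sinh (x + i y)|^2 = sinh^2 x + sin^2 y reduces the claim to s^2 cosh^2 x =
  s^2 sinh^2 x + s^2, where s \<le> |sin y| \<le> 1.\<close>

lemma norm_sinh_Complex_ge:
  fixes x y s :: real
  assumes "0 \<le> s" "s \<le> \<bar>sin y\<bar>"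
  shows "s * cosh x \<le> norm (sinh (Complex x y))"
proof -
  have "(norm (sinh (Complex x y)))\<^sup>2 = (sinh x)\<^sup>2 + (sin y)\<^sup>2"
  proof -
    have "(norm (sinh (Complex x y)))\<^sup>2 = (norm (sin (\<i> * Complex x y)))\<^sup>2"
      by (simp add: sinh_conv_sin norm_mult)
    also have "\<dots> = (exp (2 * x) + inverse (exp (2 * x)) - 2 * (1 - 2 * (sin y)\<^sup>2)) / 4"
      by (simp add: norm_sin_squared cos_double_sin)
    also have "\<dots> = (sinh x)\<^sup>2 + (sin y)\<^sup>2"
      unfolding mult_2 exp_add by (simp add: sinh_def power2_eq_square exp_minus field_simps)
    finally show ?thesis .
  qed
  moreover have "(s * cosh x)\<^sup>2 \<le> (sinh x)\<^sup>2 + (sin y)\<^sup>2"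
  proof -
    have s2: "s\<^sup>2 \<le> (sin y)\<^sup>2"
      using assms by (simp add: abs_le_square_iff[symmetric])
    have "(s * cosh x)\<^sup>2 = s\<^sup>2 * (sinh x)\<^sup>2 + s\<^sup>2"
      by (simp add: power_mult_distrib cosh_square_eq algebra_simps)
    also have "\<dots> \<le> 1 * (sinh x)\<^sup>2 + s\<^sup>2"
      using s2 order_trans[OF assms(2) abs_sin_le_one[of y]] assms(1)
      by (intro add_mono mult_right_mono) (auto simp: abs_square_le_1)
    finally show ?thesis using s2 by simp
  qed
  ultimately show ?thesis
    by (metis norm_ge_zero power2_le_imp_le)
qed

lemma coth_diff:
  assumes "sinh a \<noteq> 0" "sinh b \<noteq> 0"
  shows "coth a - coth b = sinh (b - a) / (sinh a * sinh b)"
  using assms by (simp add: coth_def sinh_diff field_simps)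

section \<open>Measurability of the profile and integrability of the majorant\<close>

text \<open>For a merely Lebesgue measurable \<open>F\<close>, continuity of the inner map does not
  suffice: preimages of null sets must be null too. Off \<open>N\<close> the nonzero derivative
  ensures this, and whatever happens on \<open>N\<close> is negligible. The intended inner map is
  \<beta> \<mapsto> t - \<rho> cosh \<beta>, critical only at 0.\<close>

lemma borel_measurable_lebesgue_comp:
  fixes F :: "real \<Rightarrow> 'a::topological_space" and g g' :: "real \<Rightarrow> real"
  assumes F: "F \<in> borel_measurable lebesgue"
    and N: "negligible N"
    and der: "\<And>x. (g has_real_derivative g' x) (at x)"
    and nz: "\<And>x. x \<notin> N \<Longrightarrow> g' x \<noteq> 0"
  shows "(\<lambda>x. F (g x)) \<in> borel_measurable lebesgue"
proof -
  have compl_N: "- N \<in> sets lebesgue"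
    using sets.compl_sets[OF negligible_imp_sets[OF N]] by (simp add: Compl_eq_Diff_UNIV)
  have cont: "continuous_on UNIV g"
    using der by (meson DERIV_isCont continuous_at_imp_continuous_on)
  have g_meas: "g \<in> borel_measurable lebesgue"
    using cont by (intro measurable_completion) (auto intro: borel_measurable_continuous_onI)
  have vim: "{x \<in> - N. g x \<in> T} \<in> sets lebesgue" if "T \<in> sets lebesgue" for T
  proof -
    have "g \<in> borel_measurable (lebesgue_on (- N))"
      using g_meas by (rule measurable_restrict_space1)
    \<comment> \<open>In dimension one a nonzero derivative is an injective linear map, which is
      what the theorem on preimages of null sets asks for.\<close>
    moreover have "{x \<in> - N. g x \<in> U} \<in> sets lebesgue" if "negligible U" "U \<subseteq> UNIV" for U
      using that nz der
      by (intro negligible_imp_sets negligible_differentiable_vimage[where f' = "\<lambda>x h. h * g' x"])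
        (auto simp: inj_def has_field_derivative_def mult_commute_abs intro: has_derivative_at_withinI)
    ultimately show ?thesis
      using double_lebesgue_sets[OF compl_N, of UNIV g] that by auto
  qed
  show ?thesis
  proof (rule measurableI)
    fix A :: "'a set" assume A: "A \<in> sets borel"
    have split: "(\<lambda>x. F (g x)) -` A \<inter> space lebesgue
        = {x \<in> - N. F (g x) \<in> A} \<union> {x \<in> N. F (g x) \<in> A}"
      by auto
    have "F -` A \<in> sets lebesgue"
      using measurable_sets[OF F A] by simp
    from vim[OF this] have "{x \<in> - N. F (g x) \<in> A} \<in> sets lebesgue" by simp
    moreover have "{x \<in> N. F (g x) \<in> A} \<in> sets lebesgue"
      by (rule negligible_imp_sets, rule negligible_subset[OF N]) auto
    ultimately show "(\<lambda>x. F (g x)) -` A \<inter> space lebesgue \<in> sets lebesgue"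
      unfolding split by (rule sets.Un)
  qed auto
qed

text \<open>The truncations of \<open>F\<close> to [-n, n] are integrable, hence measurable, and
  converge pointwise to \<open>F\<close>.\<close>

lemma locally_L1_imp_measurable:
  assumes "locally_L1 F"
  shows "F \<in> borel_measurable lebesgue"
proof (rule borel_measurable_LIMSEQ_metric)
  fix n :: nat
  have "F absolutely_integrable_on {- real n..real n}"
    using assms by (auto simp: locally_L1_def)
  then show "(\<lambda>x. indicator {- real n..real n} x *\<^sub>R F x) \<in> borel_measurable lebesgue"
    by (auto simp: set_integrable_def)
next
  fix x :: real
  obtain m :: nat where "\<bar>x\<bar> \<le> real m" using real_arch_simple by blast
  then have "\<forall>\<^sub>F n in sequentially. F x = indicator {- real n..real n} x *\<^sub>R F x"
    by (intro eventually_sequentiallyI[of m]) (auto simp: indicator_def)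
  then show "(\<lambda>n. indicator {- real n..real n} x *\<^sub>R F x) \<longlonglongrightarrow> F x"
    using tendsto_eventually[of "\<lambda>n. indicator {- real n..real n} x *\<^sub>R F x" "F x" sequentially]
    by (simp add: eq_commute)
qed

lemma integrable_inverse_cosh:
  assumes "0 < k"
  shows "integrable lebesgue (\<lambda>x::real. 1 / cosh (k * x))"
proof -
  \<comment> \<open>One-sided exponential; \<open>f x + f (- x)\<close> dominates exp (-k |x|),
    which in turn dominates 1 / cosh (k x) up to a factor 2.\<close>
  define f where "f = (\<lambda>x::real. indicator {0..} x *\<^sub>R exp (- k * x))"
  have "(\<lambda>x. exp (- k * x)) absolutely_integrable_on {0..}"
    using integrable_on_exp_minus_to_infinity[OF assms]
    by (intro nonnegative_absolutely_integrable_1) auto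
  then have f: "integrable lborel f"
    by (subst (asm) set_integrable_def) (simp add: f_def integrable_completion)
  have "integrable lborel (\<lambda>x. 2 * (f x + f (- x)))"
    using f lborel_integrable_real_affine[OF f, of "-1" 0] by simp
  then have "integrable lborel (\<lambda>x::real. 1 / cosh (k * x))"
  proof (rule Bochner_Integration.integrable_bound)
    show "AE x in lborel. norm (1 / cosh (k * x)) \<le> norm (2 * (f x + f (- x)))"
    proof (rule AE_I2)
      fix x
      have "exp (k * \<bar>x\<bar>) \<le> 2 * cosh (k * x)"
        by (auto simp: cosh_def abs_real_def)
      then have "1 / cosh (k * x) \<le> 2 * exp (- k * \<bar>x\<bar>)"
        by (simp add: exp_minus divide_simps cosh_real_pos)
      also have "\<dots> \<le> 2 * (f x + f (- x))"
        by (auto simp: f_def indicator_def)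
      finally show "norm (1 / cosh (k * x)) \<le> norm (2 * (f x + f (- x)))"
        by simp
    qed
  qed (auto intro!: borel_measurable_continuous_onI continuous_intros)
  then show ?thesis by (simp add: integrable_completion)
qed

section \<open>Uniform decay of the kernel\<close>

lemma norm_inverse_sinh_Complex_le:
  assumes "0 < s" "s \<le> \<bar>sin y\<bar>"
  shows "norm (1 / sinh (Complex x y)) \<le> 1 / (s * cosh x)"
proof -
  have "norm (1 / sinh (Complex x y)) = 1 / norm (sinh (Complex x y))"
    by (simp add: norm_divide)
  also have "\<dots> \<le> 1 / (s * cosh x)"
    using norm_sinh_Complex_ge[of s y x] assms mult_pos_pos[OF assms(1) cosh_real_pos[of x]]
    by (intro frac_le) auto
  finally show ?thesis .
qed

lemma sinh_Complex_nonzero: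
  assumes "0 < s" "s \<le> \<bar>sin y\<bar>"
  shows "sinh (Complex x y) \<noteq> 0"
proof -
  have "0 < norm (sinh (Complex x y))"
    using norm_sinh_Complex_ge[of s y x] assms mult_pos_pos[OF assms(1) cosh_real_pos[of x]]
    by linarith
  then show ?thesis by (simp only: zero_less_norm_iff not_False_eq_True)
qed

text \<open>In the quotient given by \<open>coth_diff\<close> the numerator is sinh of a purely
  imaginary number, since both arguments share the real part, and so has norm at most 1. The
  denominator supplies two factors s cosh x; one cosh x \<ge> 1 is given up so that the bound has
  the same shape as for 1 / sinh.\<close>

lemma norm_coth_diff_Complex_le:
  assumes "0 < s" "s \<le> \<bar>sin y\<bar>" "s \<le> \<bar>sin y'\<bar>"
  shows "norm (coth (Complex x y) - coth (Complex x y')) \<le> 1 / (s\<^sup>2 * cosh x)"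
proof -
  have c: "1 \<le> cosh x" by (rule cosh_real_ge_1)
  have "\<i> * (Complex x y' - Complex x y) = - of_real (y' - y)"
    by (simp add: complex_eq_iff)
  then have "norm (sinh (Complex x y' - Complex x y)) = norm (sin (of_real (y' - y) :: complex))"
    unfolding sinh_conv_sin norm_mult by (simp del: of_real_diff)
  also have "\<dots> = \<bar>sin (y' - y)\<bar>"
    by (simp only: sin_of_real norm_of_real real_norm_def)
  also have "\<dots> \<le> 1" by simp
  finally have num: "norm (sinh (Complex x y' - Complex x y)) \<le> 1" .
  have "norm (coth (Complex x y) - coth (Complex x y'))
      = norm (sinh (Complex x y' - Complex x y)) *
        (norm (1 / sinh (Complex x y)) * norm (1 / sinh (Complex x y')))"
    using sinh_Complex_nonzero[OF assms(1,2)] sinh_Complex_nonzero[OF assms(1,3)]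
    by (simp add: coth_diff norm_mult norm_divide)
  also have "\<dots> \<le> 1 * (1 / (s * cosh x) * (1 / (s * cosh x)))"
    using assms c num
    by (intro mult_mono norm_inverse_sinh_Complex_le) auto
  also have "\<dots> \<le> 1 / (s\<^sup>2 * cosh x)"
  proof -
    have "s\<^sup>2 * cosh x \<le> s\<^sup>2 * cosh x * cosh x"
      using mult_left_mono[OF c, of "s\<^sup>2 * cosh x"] c by simp
    then show ?thesis
      using assms c by (auto simp: power2_eq_square mult_ac intro!: divide_left_mono)
  qed
  finally show ?thesis .
qed

text \<open>The shifts in \<open>Zker\<close> and \<open>Hker\<close> add up so that every term is
  evaluated at q\<beta> + i q y for one of the four y in the assumptions. A single coth does not
  decay, so the first term is paired with the third and the second with the fourth; their values of
  y differ by 2\<pi>.\<close>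

lemma norm_Zker_le:
  assumes s: "0 < s"
    and "s \<le> \<bar>sin (q \<phi> * (\<theta> - \<alpha>))\<bar>" "s \<le> \<bar>sin (q \<phi> * (\<theta> - 2 * pi + \<alpha>))\<bar>"
      "s \<le> \<bar>sin (q \<phi> * (\<theta> - 2 * pi - \<alpha>))\<bar>" "s \<le> \<bar>sin (q \<phi> * (\<theta> - 4 * pi + \<alpha>))\<bar>"
  shows "norm (Zker bc \<phi> \<alpha> (of_real \<beta> + \<i> * of_real \<theta>)) \<le> 4 / s\<^sup>2 * (1 / cosh (q \<phi> * \<beta>))"
proof -
  let ?z = "\<lambda>y. Complex (q \<phi> * \<beta>) (q \<phi> * y)"
  have z1: "q \<phi> * (of_real \<beta> + \<i> * of_real \<theta> - \<i> * pi / 2 + \<i> * pi / 2 - \<i> * \<alpha>) = ?z (\<theta> - \<alpha>)"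
    and z2: "q \<phi> * (of_real \<beta> + \<i> * of_real \<theta> - \<i> * pi / 2 - 3 * \<i> * pi / 2 + \<i> * \<alpha>) = ?z (\<theta> - 2 * pi + \<alpha>)"
    and z3: "q \<phi> * (of_real \<beta> + \<i> * of_real \<theta> - 5 * \<i> * pi / 2 + \<i> * pi / 2 - \<i> * \<alpha>) = ?z (\<theta> - 2 * pi - \<alpha>)"
    and z4: "q \<phi> * (of_real \<beta> + \<i> * of_real \<theta> - 5 * \<i> * pi / 2 - 3 * \<i> * pi / 2 + \<i> * \<alpha>) = ?z (\<theta> - 4 * pi + \<alpha>)"
    by (auto simp: complex_eq_iff algebra_simps)
  note z = z1 z2 z3 z4
  have c: "0 < cosh (q \<phi> * \<beta>)" by (rule cosh_real_pos)
  have coth_case: "norm (coth (?z (\<theta> - 2 * pi - \<alpha>)) - coth (?z (\<theta> - \<alpha>))) \<le> 1 / (s\<^sup>2 * cosh (q \<phi> * \<beta>))"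
    "norm (coth (?z (\<theta> - 4 * pi + \<alpha>)) - coth (?z (\<theta> - 2 * pi + \<alpha>))) \<le> 1 / (s\<^sup>2 * cosh (q \<phi> * \<beta>))"
    using assms by (auto intro: norm_coth_diff_Complex_le)
  \<comment> \<open>Since s \<le> 1, the bound 1 / (s cosh) for 1 / sinh can be relaxed to the bound
    1 / (s^2 cosh) obtained for coth differences.\<close>
  have "s \<le> 1" using assms(2) abs_sin_le_one order_trans by blast
  then have "s\<^sup>2 \<le> s" using s by (simp add: power2_eq_square mult_left_le)
  then have "1 / (s * cosh (q \<phi> * \<beta>)) \<le> 1 / (s\<^sup>2 * cosh (q \<phi> * \<beta>))"
    using s c by (intro divide_left_mono mult_right_mono) auto
  then have sinh_case: "norm (1 / sinh (?z y)) \<le> 1 / (s\<^sup>2 * cosh (q \<phi> * \<beta>))"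
    if "s \<le> \<bar>sin (q \<phi> * y)\<bar>" for y
    using norm_inverse_sinh_Complex_le[OF s that, of "q \<phi> * \<beta>"] by linarith
  \<comment> \<open>DD and NN consist of two coth differences, DN of four separate terms; the
    constant 4 covers all cases.\<close>
  have two: "2 * (1 / (s\<^sup>2 * cosh (q \<phi> * \<beta>))) \<le> 4 / s\<^sup>2 * (1 / cosh (q \<phi> * \<beta>))"
    and four: "4 * (1 / (s\<^sup>2 * cosh (q \<phi> * \<beta>))) = 4 / s\<^sup>2 * (1 / cosh (q \<phi> * \<beta>))"
    using s c by (auto simp: field_simps)
  show ?thesis
  proof (cases bc)
    case DD
    have "Zker bc \<phi> \<alpha> (of_real \<beta> + \<i> * of_real \<theta>)
        = (coth (?z (\<theta> - 2 * pi - \<alpha>)) - coth (?z (\<theta> - \<alpha>)))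
          - (coth (?z (\<theta> - 4 * pi + \<alpha>)) - coth (?z (\<theta> - 2 * pi + \<alpha>)))"
      unfolding Zker_def DD Hker.simps z by simp
    then show ?thesis
      using norm_triangle_ineq4[of "coth (?z (\<theta> - 2 * pi - \<alpha>)) - coth (?z (\<theta> - \<alpha>))"
          "coth (?z (\<theta> - 4 * pi + \<alpha>)) - coth (?z (\<theta> - 2 * pi + \<alpha>))"] coth_case two by simp
  next
    case NN
    have "Zker bc \<phi> \<alpha> (of_real \<beta> + \<i> * of_real \<theta>)
        = (coth (?z (\<theta> - 2 * pi - \<alpha>)) - coth (?z (\<theta> - \<alpha>)))
          + (coth (?z (\<theta> - 4 * pi + \<alpha>)) - coth (?z (\<theta> - 2 * pi + \<alpha>)))"
      unfolding Zker_def NN Hker.simps z by simp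
    then show ?thesis
      using norm_triangle_ineq[of "coth (?z (\<theta> - 2 * pi - \<alpha>)) - coth (?z (\<theta> - \<alpha>))"
          "coth (?z (\<theta> - 4 * pi + \<alpha>)) - coth (?z (\<theta> - 2 * pi + \<alpha>))"] coth_case two by simp
  next
    case DN
    have "Zker bc \<phi> \<alpha> (of_real \<beta> + \<i> * of_real \<theta>)
        = - (1 / sinh (?z (\<theta> - \<alpha>)) + 1 / sinh (?z (\<theta> - 2 * pi + \<alpha>)))
          + (1 / sinh (?z (\<theta> - 2 * pi - \<alpha>)) + 1 / sinh (?z (\<theta> - 4 * pi + \<alpha>)))"
      unfolding Zker_def DN Hker.simps z by simp
    also have "norm \<dots> \<le> (norm (1 / sinh (?z (\<theta> - \<alpha>))) + norm (1 / sinh (?z (\<theta> - 2 * pi + \<alpha>))))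
        + (norm (1 / sinh (?z (\<theta> - 2 * pi - \<alpha>))) + norm (1 / sinh (?z (\<theta> - 4 * pi + \<alpha>))))"
      by (intro order_trans[OF norm_triangle_ineq] add_mono)
        (simp_all only: norm_minus_cancel norm_triangle_ineq)
    also have "\<dots> \<le> 4 * (1 / (s\<^sup>2 * cosh (q \<phi> * \<beta>)))"
      using sinh_case[OF assms(2)] sinh_case[OF assms(3)] sinh_case[OF assms(4)] sinh_case[OF assms(5)]
      by linarith
    finally show ?thesis unfolding four .
  qed
qed

text \<open>Quotients of continuous functions are Borel even across a pole, where division by zero
  gives 0, so this holds for every \<theta>.\<close>

lemma Zker_line_measurable:
  "(\<lambda>\<beta>. Zker bc \<phi> \<alpha> (of_real \<beta> + \<i> * of_real \<theta>)) \<in> borel_measurable lebesgue"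
proof -
  have "(\<lambda>\<beta>::real. Zker bc \<phi> \<alpha> (of_real \<beta> + \<i> * of_real \<theta>)) \<in> borel_measurable borel"
    unfolding Zker_def
    by (cases bc; simp only: Hker.simps coth_def;
        intro borel_measurable_add borel_measurable_diff borel_measurable_uminus borel_measurable_divide
          borel_measurable_const borel_measurable_continuous_onI continuous_intros; simp)
  then show ?thesis by (intro measurable_completion) simp
qed

section \<open>Distance from the poles\<close>

text \<open>Compactness of \<open>K\<close> turns pointwise nonvanishing of the four sines into a
  common positive lower bound.\<close>

lemma sin_lower_bound:
  assumes "0 < \<phi>" "\<phi> < pi" "max 0 (\<phi> - pi / 2) < \<alpha>" "\<alpha> < min (pi / 2) \<phi>" "0 < \<delta>"
  defines "K \<equiv> {\<theta> \<in> {\<phi>..2 * pi}. \<delta> \<le> \<bar>\<theta> - \<theta>1 \<phi> \<alpha>\<bar> \<and> \<delta> \<le> \<bar>\<theta> - \<theta>2 \<alpha>\<bar>}"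
  obtains s where "0 < s"
    "\<And>\<theta>. \<theta> \<in> K \<Longrightarrow> s \<le> \<bar>sin (q \<phi> * (\<theta> - \<alpha>))\<bar> \<and> s \<le> \<bar>sin (q \<phi> * (\<theta> - 2 * pi + \<alpha>))\<bar> \<and>
      s \<le> \<bar>sin (q \<phi> * (\<theta> - 2 * pi - \<alpha>))\<bar> \<and> s \<le> \<bar>sin (q \<phi> * (\<theta> - 4 * pi + \<alpha>))\<bar>"
proof (cases "K = {}")
  \<comment> \<open>A large \<delta> may exclude every angle; then any positive \<open>s\<close>
    will do.\<close>
  case True
  then show thesis by (intro that[of 1]) auto
next
  case False
  define f where "f = (\<lambda>\<theta>. min (min \<bar>sin (q \<phi> * (\<theta> - \<alpha>))\<bar> \<bar>sin (q \<phi> * (\<theta> - 2 * pi + \<alpha>))\<bar>)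
    (min \<bar>sin (q \<phi> * (\<theta> - 2 * pi - \<alpha>))\<bar> \<bar>sin (q \<phi> * (\<theta> - 4 * pi + \<alpha>))\<bar>))"
  have Phi: "0 < \<Phi> \<phi>" using assms by (simp add: \<Phi>_def)
  \<comment> \<open>Because q = \<pi> / (2\<Phi>), the zeros in y are the multiples of 2\<Phi>; the
    open window from -4\<Phi> to 2\<Phi> contains only 0 and -2\<Phi>.\<close>
  have sin_nz: "sin (q \<phi> * y) \<noteq> 0" if "- 4 * \<Phi> \<phi> < y" "y < 2 * \<Phi> \<phi>" "y \<noteq> 0" "y \<noteq> - 2 * \<Phi> \<phi>" for y
  proof
    assume "sin (q \<phi> * y) = 0"
    then obtain n :: int where "q \<phi> * y = of_int n * pi"
      by (auto simp: sin_zero_iff_int2)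
    then have y: "y = of_int n * (2 * \<Phi> \<phi>)"
      using Phi by (simp add: q_def field_simps)
    then have "- 2 * (2 * \<Phi> \<phi>) < of_int n * (2 * \<Phi> \<phi>)" "of_int n * (2 * \<Phi> \<phi>) < 1 * (2 * \<Phi> \<phi>)"
      using that by auto
    then have "- 2 < (of_int n :: real)" "(of_int n :: real) < 1"
      using Phi by (auto simp only: mult_less_cancel_right)
    then have "n = 0 \<or> n = -1" by linarith
    then show False using y that by auto
  qed
  have pos: "0 < f \<theta>" if "\<theta> \<in> K" for \<theta>
  proof -
    have \<theta>: "\<phi> \<le> \<theta>" "\<theta> \<le> 2 * pi" "\<theta> \<noteq> 2 * \<phi> - \<alpha>" "\<theta> \<noteq> 2 * pi - \<alpha>"
      using that assms by (auto simp: K_def \<theta>1_def \<theta>2_def)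
    \<comment> \<open>All four shifts lie in this window. Only \<theta> - 2\<pi> + \<alpha> can be
      0, at \<theta> = \<theta>2, and only \<theta> - 4\<pi> + \<alpha> can be -2\<Phi>, at \<theta>
      = \<theta>1.\<close>
    have "sin (q \<phi> * (\<theta> - \<alpha>)) \<noteq> 0" "sin (q \<phi> * (\<theta> - 2 * pi + \<alpha>)) \<noteq> 0"
      "sin (q \<phi> * (\<theta> - 2 * pi - \<alpha>)) \<noteq> 0" "sin (q \<phi> * (\<theta> - 4 * pi + \<alpha>)) \<noteq> 0"
      using \<theta> assms(1-4) by (intro sin_nz; auto simp: \<Phi>_def)+
    then show ?thesis by (simp add: f_def)
  qed
  have "K = {\<phi>..2 * pi} \<inter> ({\<theta>. \<delta> \<le> \<bar>\<theta> - \<theta>1 \<phi> \<alpha>\<bar>} \<inter> {\<theta>. \<delta> \<le> \<bar>\<theta> - \<theta>2 \<alpha>\<bar>})"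
    by (auto simp: K_def)
  then have "compact K"
    by (auto intro!: compact_Int_closed closed_Int closed_Collect_le continuous_intros)
  moreover have "continuous_on K f"
    unfolding f_def by (intro continuous_intros)
  ultimately obtain m where "m \<in> K" "\<And>\<theta>. \<theta> \<in> K \<Longrightarrow> f m \<le> f \<theta>"
    using continuous_attains_inf[of K f] False by blast
  moreover have "f \<theta> \<le> \<bar>sin (q \<phi> * (\<theta> - \<alpha>))\<bar>" "f \<theta> \<le> \<bar>sin (q \<phi> * (\<theta> - 2 * pi + \<alpha>))\<bar>"
    "f \<theta> \<le> \<bar>sin (q \<phi> * (\<theta> - 2 * pi - \<alpha>))\<bar>" "f \<theta> \<le> \<bar>sin (q \<phi> * (\<theta> - 4 * pi + \<alpha>))\<bar>" for \<theta>
    by (simp_all add: f_def min.coboundedI1 min.coboundedI2)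
  ultimately show thesis
    using pos by (intro that[of "f m"]) (blast intro: order_trans)+
qed

section \<open>Boundedness of the profile, integration limits and tails\<close>

text \<open>For negative p the weighted bound alone would permit growth. It serves on [0, T), where
  the weight is bounded; beyond T the profile is within 1 of a function bounded by |a0|, and on the
  negative axis it vanishes.\<close>

lemma profile_bounded:
  fixes F :: "real \<Rightarrow> complex"
  assumes "\<forall>s<0. F s = 0"
    and "\<exists>p::real. bdd_above (range (\<lambda>s. (1 + \<bar>s\<bar>) powr p * norm (F s)))"
    and "((\<lambda>t. F t - harmonic_profile \<omega>0 a0 t) \<longlongrightarrow> 0) at_top"
  obtains M where "\<And>s. norm (F s) \<le> M"
proof -
  obtain p C where C: "\<And>s. (1 + \<bar>s\<bar>) powr p * norm (F s) \<le> C"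
    using assms(2) by (auto simp: bdd_above_def)
  have harm: "norm (harmonic_profile \<omega>0 a0 s) \<le> norm a0" for s
    by (simp add: harmonic_profile_def heaviside_def norm_mult)
  obtain T where T: "\<And>s. T \<le> s \<Longrightarrow> norm (F s - harmonic_profile \<omega>0 a0 s) < 1"
    using tendstoD[OF assms(3), of 1] by (auto simp: eventually_at_top_linorder dist_norm)
  have C0: "0 \<le> C" using C[of 0] by simp (metis norm_ge_zero order_trans)
  \<comment> \<open>The exponent |p| handles both signs of p, and |T| keeps the constant meaningful
    when T is negative.\<close>
  have "norm (F s) \<le> max (norm a0 + 1) (C * (1 + \<bar>T\<bar>) powr \<bar>p\<bar>)" for s
  proof -
    consider "s < 0" | "T \<le> s" | "0 \<le> s" "s < T" by linarith
    then show ?thesis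
    proof cases
      case 1
      then show ?thesis using assms(1) norm_ge_zero[of a0] by (simp add: le_max_iff_disj)
    next
      case 2
      have "norm (F s) \<le> norm (F s - harmonic_profile \<omega>0 a0 s) + norm (harmonic_profile \<omega>0 a0 s)"
        using norm_triangle_sub[of "F s" "harmonic_profile \<omega>0 a0 s"] by simp
      then show ?thesis using T[OF 2] harm[of s] by simp
    next
      case 3
      have "norm (F s) = (1 + \<bar>s\<bar>) powr p * norm (F s) * (1 + \<bar>s\<bar>) powr (- p)"
        using 3 by (simp add: powr_minus field_simps)
      also have "\<dots> \<le> C * (1 + \<bar>s\<bar>) powr (- p)"
        by (intro mult_right_mono C) simp
      also have "\<dots> \<le> C * (1 + \<bar>s\<bar>) powr \<bar>p\<bar>"
        by (intro mult_left_mono powr_mono C0) auto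
      also have "\<dots> \<le> C * (1 + \<bar>T\<bar>) powr \<bar>p\<bar>"
        using 3 by (intro mult_left_mono powr_mono2 C0) auto
      finally show ?thesis by simp
    qed
  qed
  then show thesis by (rule that)
qed

text \<open>On [1, \<infinity>) the function \<open>ell\<close> is arcosh, which is increasing. This
  places [-L, L] inside the integration interval as soon as t / \<rho> \<ge> cosh L.\<close>

lemma abs_le_ell:
  assumes "\<bar>\<beta>\<bar> \<le> L" "cosh L \<le> x"
  shows "\<bar>\<beta>\<bar> \<le> ell x"
proof -
  have L: "0 \<le> L" using assms by simp
  have "1 \<le> cosh L" by (rule cosh_real_ge_1)
  then have x: "1 \<le> x" using assms by simp
  have "L = arcosh (cosh L)" using L by (simp add: arcosh_cosh_real)
  also have "\<dots> \<le> arcosh x"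
    using assms \<open>1 \<le> cosh L\<close> x by (metis arcosh_real_strict_mono order_le_less)
  finally show ?thesis using x assms by (simp add: ell_def arcosh_real_def)
qed

text \<open>Dominated convergence with majorant |w|: at each fixed x the integrand is 0 once L \<ge>
  |x|.\<close>

lemma integral_tail_tendsto_0:
  fixes w :: "real \<Rightarrow> real"
  assumes "integrable lebesgue w"
  shows "((\<lambda>L. LINT x|lebesgue. indicator {x. L < \<bar>x\<bar>} x * w x) \<longlongrightarrow> 0) at_top"
proof -
  have "((\<lambda>L. LINT x|lebesgue. indicator {x. L < \<bar>x\<bar>} x * w x) \<longlongrightarrow> (LINT x::real|lebesgue. 0)) at_top"
  proof (rule integral_dominated_convergence_at_top[where w = "\<lambda>x. \<bar>w x\<bar>"])
    have "open {x::real. L < \<bar>x\<bar>}" for L by (intro open_Collect_less continuous_intros)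
    then have "{x::real. L < \<bar>x\<bar>} \<in> sets lebesgue" for L by simp
    then show "(\<lambda>x. indicator {x. L < \<bar>x\<bar>} x * w x) \<in> borel_measurable lebesgue" for L
      using assms by (intro borel_measurable_times borel_measurable_indicator) auto
    have "\<forall>\<^sub>F L in at_top. indicator {x. L < \<bar>x\<bar>} x * w x = 0" for x
      using eventually_ge_at_top[of "\<bar>x\<bar>"] by eventually_elim auto
    then show "AE x in lebesgue. ((\<lambda>L. indicator {x. L < \<bar>x\<bar>} x * w x) \<longlongrightarrow> 0) at_top"
      by (intro AE_I2 tendsto_eventually)
  qed (use assms in \<open>auto simp: indicator_def\<close>)
  then show ?thesis by simp
qed

section \<open>Uniform convergence of the amplitudes\<close>

theorem theorem5p1:
  fixes \<phi> \<alpha> \<omega>0 \<delta> b :: real and a0 :: complex and F :: "real \<Rightarrow> complex"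
    and bc :: boundary_type
  assumes "0 < \<phi>" and "\<phi> < pi"
    and "max 0 (\<phi> - pi / 2) < \<alpha>" and "\<alpha> < min (pi / 2) \<phi>"
    and "\<omega>0 \<noteq> 0"
    and "locally_L1 F"
    and "\<forall>s<0. F s = 0"
    and "\<exists>p::real. bdd_above (range (\<lambda>s. (1 + \<bar>s\<bar>) powr p * norm (F s)))"
    and "((\<lambda>t. F t - harmonic_profile \<omega>0 a0 t) \<longlongrightarrow> 0) at_top"
    and "\<delta> > 0"
  shows "uniform_limit
           ({0<..b} \<times> {\<theta> \<in> {\<phi>..2 * pi}. \<bar>\<theta> - \<theta>1 \<phi> \<alpha>\<bar> \<ge> \<delta> \<and> \<bar>\<theta> - \<theta>2 \<alpha>\<bar> \<ge> \<delta>})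
           (\<lambda>t (\<rho>, \<theta>). diffracted_amplitude bc \<phi> \<alpha> \<omega>0 F \<rho> \<theta> t
                         - limiting_amplitude bc \<phi> \<alpha> \<omega>0 a0 \<rho> \<theta>)
           (\<lambda>_. 0) at_top"
proof -
  obtain s where s: "0 < s" and sin_ge:
    "\<And>\<theta>. \<theta> \<in> {\<theta> \<in> {\<phi>..2 * pi}. \<delta> \<le> \<bar>\<theta> - \<theta>1 \<phi> \<alpha>\<bar> \<and> \<delta> \<le> \<bar>\<theta> - \<theta>2 \<alpha>\<bar>} \<Longrightarrow>
      s \<le> \<bar>sin (q \<phi> * (\<theta> - \<alpha>))\<bar> \<and> s \<le> \<bar>sin (q \<phi> * (\<theta> - 2 * pi + \<alpha>))\<bar> \<and>
      s \<le> \<bar>sin (q \<phi> * (\<theta> - 2 * pi - \<alpha>))\<bar> \<and> s \<le> \<bar>sin (q \<phi> * (\<theta> - 4 * pi + \<alpha>))\<bar>"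
    using sin_lower_bound[OF assms(1-4,10)] by blast
  \<comment> \<open>Integrable majorant of the kernel, independent of the admissible angle
    \<theta>.\<close>
  define w where "w = (\<lambda>\<beta>. 4 / s\<^sup>2 * (1 / cosh (q \<phi> * \<beta>)))"
  have Phi: "0 < \<Phi> \<phi>" using assms by (simp add: \<Phi>_def)
  then have "0 < q \<phi>" by (simp add: q_def)
  then have w_int: "integrable lebesgue w"
    unfolding w_def by (intro integrable_mult_right integrable_inverse_cosh)
  have w_nonneg: "0 \<le> w \<beta>" for \<beta>
    by (simp add: w_def less_imp_le[OF cosh_real_pos])
  obtain M0 where M0: "\<And>s. norm (F s) \<le> M0"
    using profile_bounded[OF assms(7-9)] by blast
  then have M0_nonneg: "0 \<le> M0" using norm_ge_zero order_trans by blast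
  define M where "M = M0 + norm a0"
  define W where "W = (LINT \<beta>|lebesgue. w \<beta>)"
  define c where "c = 1 / (4 * \<Phi> \<phi>)"
  have nonneg: "0 \<le> M" "0 \<le> W" "0 < c"
    using M0_nonneg w_nonneg Phi by (auto simp: M_def W_def c_def)
  have F_meas: "F \<in> borel_measurable lebesgue"
    using assms(6) by (rule locally_L1_imp_measurable)
  show ?thesis
  proof (rule uniform_limitI)
    fix \<epsilon> :: real assume "0 < \<epsilon>"
    \<comment> \<open>Chosen so that the final bound c \<eta> (W + M) equals \<epsilon> - \<eta>;
      the summand 1 keeps the denominator positive and the final inequality strict.\<close>
    define \<eta> where "\<eta> = \<epsilon> / (c * (W + M) + 1)"
    have denom: "0 < c * (W + M) + 1" using nonneg by (intro add_nonneg_pos) auto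
    then have \<eta>: "0 < \<eta>" "\<eta> * (c * (W + M) + 1) = \<epsilon>"
      using \<open>0 < \<epsilon>\<close> by (auto simp: \<eta>_def)
    define \<tau> where "\<tau> = (\<lambda>L. LINT \<beta>|lebesgue. indicator {\<beta>. L < \<bar>\<beta>\<bar>} \<beta> * w \<beta>)"
    have "\<forall>\<^sub>F L in at_top. dist (\<tau> L) 0 < \<eta> \<and> 0 \<le> L"
      unfolding \<tau>_def using \<eta>
      by (intro eventually_conj tendstoD[OF integral_tail_tendsto_0[OF w_int]] eventually_ge_at_top)
    then obtain L where L: "dist (\<tau> L) 0 < \<eta>" "0 \<le> L"
      using eventually_happens'[OF trivial_limit_at_top_linorder] by blast
    then have tail: "\<tau> L < \<eta>" by (simp add: dist_real_def)
    obtain T where T: "\<And>u. T \<le> u \<Longrightarrow> norm (F u - harmonic_profile \<omega>0 a0 u) < \<eta>"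
      using tendstoD[OF assms(9) \<eta>(1)] by (auto simp: eventually_at_top_linorder dist_norm)
    define B where "B = max b 0"
    \<comment> \<open>Beyond this threshold t - \<rho> cosh \<beta> \<ge> max T 1 whenever |\<beta>|
      \<le> L and \<rho> \<le> b: T makes the remainder small, 1 puts the argument where the
      Heaviside function is 1. It also gives t / \<rho> \<ge> cosh L.\<close>
    have "\<forall>\<^sub>F t in at_top. B * cosh L + max T 1 \<le> t"
      by (rule eventually_ge_at_top)
    then show "\<forall>\<^sub>F t in at_top. \<forall>x\<in>{0<..b} \<times> {\<theta> \<in> {\<phi>..2 * pi}. \<delta> \<le> \<bar>\<theta> - \<theta>1 \<phi> \<alpha>\<bar> \<and> \<delta> \<le> \<bar>\<theta> - \<theta>2 \<alpha>\<bar>}.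
        dist (case x of (\<rho>, \<theta>) \<Rightarrow> diffracted_amplitude bc \<phi> \<alpha> \<omega>0 F \<rho> \<theta> t
          - limiting_amplitude bc \<phi> \<alpha> \<omega>0 a0 \<rho> \<theta>) 0 < \<epsilon>"
    proof (eventually_elim, clarify)
      fix t \<rho> \<theta>
      assume t: "B * cosh L + max T 1 \<le> t" and \<rho>: "\<rho> \<in> {0<..b}"
        and \<theta>: "\<theta> \<in> {\<phi>..2 * pi}" "\<delta> \<le> \<bar>\<theta> - \<theta>1 \<phi> \<alpha>\<bar>" "\<delta> \<le> \<bar>\<theta> - \<theta>2 \<alpha>\<bar>"
      define z where "z = (\<lambda>\<beta>::real. Zker bc \<phi> \<alpha> (of_real \<beta> + \<i> * of_real \<theta>))"
      have z_le: "norm (z \<beta>) \<le> w \<beta>" for \<beta>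
        unfolding z_def w_def using sin_ge[of \<theta>] \<theta> s by (intro norm_Zker_le) auto
      have z_meas: "z \<in> borel_measurable lebesgue"
        unfolding z_def by (rule Zker_line_measurable)
      define I where "I = {- ell (t / \<rho>)..ell (t / \<rho>)}"
      define e where "e = exp (\<i> * of_real \<omega>0 * of_real t)"
      \<comment> \<open>The indicator extends the integrand of the diffracted amplitude to the whole
        line, so that it can be subtracted from that of the limiting amplitude.\<close>
      define D1 where "D1 = (\<lambda>\<beta>. indicator I \<beta> *\<^sub>R (z \<beta> * F (t - \<rho> * cosh \<beta>)))"
      define D2 where "D2 = (\<lambda>\<beta>. a0 * exp (\<i> * of_real \<omega>0 * of_real \<rho> * of_real (cosh \<beta>)) * z \<beta>)"
      have e: "norm e = 1" by (simp add: e_def)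
      have D1_le: "norm (D1 \<beta>) \<le> M0 * w \<beta>" for \<beta>
        using mult_mono[OF M0 z_le M0_nonneg, of \<beta> "t - \<rho> * cosh \<beta>"] w_nonneg[of \<beta>] M0_nonneg
        by (auto simp: D1_def indicator_def norm_mult mult.commute)
      have D2_le: "norm (D2 \<beta>) \<le> norm a0 * w \<beta>" for \<beta>
        using z_le[of \<beta>] by (simp add: D2_def norm_mult mult_left_mono)
      have "(\<lambda>\<beta>. F (t - \<rho> * cosh \<beta>)) \<in> borel_measurable lebesgue"
        by (rule borel_measurable_lebesgue_comp[OF F_meas, of "{0}" _ "\<lambda>\<beta>. - (\<rho> * sinh \<beta>)"])
          (use \<rho> in \<open>auto intro!: derivative_eq_intros\<close>)
      then have "D1 \<in> borel_measurable lebesgue"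
        unfolding D1_def I_def
        by (intro borel_measurable_scaleR borel_measurable_indicator borel_measurable_times z_meas) auto
      then have D1_int: "integrable lebesgue D1"
        by (rule Bochner_Integration.integrable_bound[OF integrable_mult_right[OF w_int, of M0]])
          (auto intro!: AE_I2 order_trans[OF D1_le])
      have "(\<lambda>\<beta>::real. a0 * exp (\<i> * of_real \<omega>0 * of_real \<rho> * of_real (cosh \<beta>))) \<in> borel_measurable lebesgue"
        by (intro measurable_completion)
          (simp, intro borel_measurable_continuous_onI continuous_intros)
      then have "D2 \<in> borel_measurable lebesgue"
        unfolding D2_def using z_meas by (rule borel_measurable_times)
      then have D2_int: "integrable lebesgue D2"
        by (rule Bochner_Integration.integrable_bound[OF integrable_mult_right[OF w_int, of "norm a0"]])
          (auto intro!: AE_I2 order_trans[OF D2_le])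
      have bound: "norm (e * D1 \<beta> - D2 \<beta>) \<le> \<eta> * w \<beta> + M * (indicator {\<beta>. L < \<bar>\<beta>\<bar>} \<beta> * w \<beta>)" for \<beta>
      proof (cases "\<bar>\<beta>\<bar> \<le> L")
        case True
        define u where "u = t - \<rho> * cosh \<beta>"
        have "cosh \<beta> \<le> cosh L"
          using True by (metis abs_ge_zero cosh_real_abs cosh_real_nonneg_le_iff L(2))
        then have "\<rho> * cosh \<beta> \<le> \<rho> * cosh L" using \<rho> by simp
        moreover have \<rho>L: "\<rho> * cosh L \<le> B * cosh L"
          using \<rho> by (intro mult_right_mono) (auto simp: B_def less_imp_le[OF cosh_real_pos])
        ultimately have u: "max T 1 \<le> u"
          using t unfolding u_def by linarith
        have "\<rho> * cosh L \<le> t" using \<rho>L t by linarith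
        then have "cosh L \<le> t / \<rho>" using \<rho> by (simp add: field_simps)
        then have "\<bar>\<beta>\<bar> \<le> ell (t / \<rho>)"
          by (rule abs_le_ell[OF True])
        then have "\<beta> \<in> I"
          unfolding I_def by auto
        \<comment> \<open>The phases combine, \<omega>0 t - \<omega>0 (t - \<rho> cosh \<beta>) =
          \<omega>0 \<rho> cosh \<beta>, so the harmonic part of \<open>F\<close> reproduces the
          limiting integrand exactly and only the remainder is left.\<close>
        have "e * harmonic_profile \<omega>0 a0 u = a0 * (e * exp (- \<i> * of_real \<omega>0 * of_real u))"
          using u by (simp add: harmonic_profile_def heaviside_def)
        also have "e * exp (- \<i> * of_real \<omega>0 * of_real u)
            = exp (\<i> * of_real \<omega>0 * of_real \<rho> * of_real (cosh \<beta>))"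
          unfolding e_def exp_add[symmetric]
          by (rule arg_cong[where f = exp]) (simp add: u_def algebra_simps)
        finally have "e * D1 \<beta> - D2 \<beta> = e * z \<beta> * (F u - harmonic_profile \<omega>0 a0 u)"
          using \<open>\<beta> \<in> I\<close> by (simp add: D1_def D2_def u_def[symmetric] algebra_simps)
        then have "norm (e * D1 \<beta> - D2 \<beta>) = norm (F u - harmonic_profile \<omega>0 a0 u) * norm (z \<beta>)"
          by (simp add: norm_mult e)
        also have "\<dots> \<le> \<eta> * w \<beta>"
          using T[of u] u z_le[of \<beta>] \<eta> by (intro mult_mono) auto
        finally show ?thesis using True by simp
      next
        case False
        \<comment> \<open>No cancellation is sought here: \<open>\<beta>\<close> may lie inside or
          outside \<open>I\<close>, and the two integrands are bounded separately, together by
          \<open>M * w \<beta>\<close>.\<close>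
        have "norm (e * D1 \<beta> - D2 \<beta>) \<le> norm (D1 \<beta>) + norm (D2 \<beta>)"
          using norm_triangle_ineq4[of "e * D1 \<beta>" "D2 \<beta>"] by (simp add: norm_mult e)
        also have "\<dots> \<le> M * w \<beta>"
          using D1_le[of \<beta>] D2_le[of \<beta>] by (simp add: M_def distrib_right)
        also have "\<dots> \<le> \<eta> * w \<beta> + M * w \<beta>"
          using \<eta> w_nonneg[of \<beta>] by simp
        finally show ?thesis using False by simp
      qed
      have tail_int: "integrable lebesgue (\<lambda>\<beta>. indicator {\<beta>. L < \<bar>\<beta>\<bar>} \<beta> * w \<beta>)"
      proof (rule Bochner_Integration.integrable_bound[OF w_int])
        have "open {\<beta>::real. L < \<bar>\<beta>\<bar>}" by (intro open_Collect_less continuous_intros)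
        then have "{\<beta>::real. L < \<bar>\<beta>\<bar>} \<in> sets lebesgue" by simp
        then show "(\<lambda>\<beta>. indicator {\<beta>. L < \<bar>\<beta>\<bar>} \<beta> * w \<beta>) \<in> borel_measurable lebesgue"
          using w_int by (intro borel_measurable_times borel_measurable_indicator) auto
      qed (auto simp: indicator_def)
      have "norm (LINT \<beta>|lebesgue. e * D1 \<beta> - D2 \<beta>)
          \<le> (LINT \<beta>|lebesgue. \<eta> * w \<beta> + M * (indicator {\<beta>. L < \<bar>\<beta>\<bar>} \<beta> * w \<beta>))"
      proof (rule Bochner_Integration.integral_norm_bound_integral)
        show "integrable lebesgue (\<lambda>\<beta>. e * D1 \<beta> - D2 \<beta>)"
          using D1_int D2_int by simp
        show "integrable lebesgue (\<lambda>\<beta>. \<eta> * w \<beta> + M * (indicator {\<beta>. L < \<bar>\<beta>\<bar>} \<beta> * w \<beta>))"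
          by (intro Bochner_Integration.integrable_add integrable_mult_right w_int tail_int)
      qed (rule bound)
      also have "\<dots> = \<eta> * W + M * \<tau> L"
        using w_int tail_int by (simp add: W_def \<tau>_def)
      also have "\<dots> \<le> \<eta> * (W + M)"
        using mult_left_mono[OF less_imp_le[OF tail] nonneg(1)] by (simp add: algebra_simps)
      finally have int_le: "norm (LINT \<beta>|lebesgue. e * D1 \<beta> - D2 \<beta>) \<le> \<eta> * (W + M)" .
      have "diffracted_amplitude bc \<phi> \<alpha> \<omega>0 F \<rho> \<theta> t - limiting_amplitude bc \<phi> \<alpha> \<omega>0 a0 \<rho> \<theta>
          = \<i> / (4 * \<Phi> \<phi>) * (e * (LINT \<beta>|lebesgue. D1 \<beta>) - (LINT \<beta>|lebesgue. D2 \<beta>))"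
        unfolding diffracted_amplitude_def limiting_amplitude_def set_lebesgue_integral_def
          D1_def D2_def z_def I_def e_def by (simp add: algebra_simps)
      also have "e * (LINT \<beta>|lebesgue. D1 \<beta>) - (LINT \<beta>|lebesgue. D2 \<beta>)
          = (LINT \<beta>|lebesgue. e * D1 \<beta> - D2 \<beta>)"
        using D1_int D2_int by simp
      also have "norm (\<i> / (4 * \<Phi> \<phi>) * \<dots>) \<le> c * (\<eta> * (W + M))"
        using int_le Phi nonneg(3) by (simp add: norm_mult norm_divide c_def divide_right_mono)
      \<comment> \<open>By the choice of \<eta> the left side is \<epsilon> - \<eta>.\<close>
      also have "\<dots> < \<epsilon>"
        using \<eta> by (simp add: algebra_simps)
      finally show "dist (diffracted_amplitude bc \<phi> \<alpha> \<omega>0 F \<rho> \<theta> t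
          - limiting_amplitude bc \<phi> \<alpha> \<omega>0 a0 \<rho> \<theta>) 0 < \<epsilon>"
        by (simp add: dist_norm)
    qed
  qed
qed

end
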